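(* The class of $\lesssim$-completely $(\dot\cup,\emptyset)$-representable partial algebras, viewed as a class of $\mathcal L(J,0)$-structures, is not closed under elementary equivalence.
   Context: For sets $S,T$, the disjoint union $S\mathbin{\dot\cup}T$ equals $S\cup T$ if $S\cap T=\emptyset$, and is undefined otherwise. A partial $(\dot\cup,\emptyset)$-algebra of sets is a subset of $\wp(X)$, for some set $X$, containing $\emptyset$ and closed under $\dot\cup$ wherever it is defined. A partial $(\dot\sqcup,0)$-algebra is a set with a partial binary operation $\dot\sqcup$ and a constant $0$. A $(\dot\cup,\emptyset)$-representation of it is a bijection $\theta$ onto a partial $(\dot\cup,\emptyset)$-algebra of sets with $0^\theta=\emptyset$, such that $a\mathbin{\dot\sqcup}b$ is defined if and only if $a^\theta\mathbin{\dot\cup}b^\theta$ is defined, and then $(a\mathbin{\dot\sqcup}b)^\theta=a^\theta\mathbin{\dot\cup}b^\theta$. On such an algebra $\mathfrak A$ define $a\lesssim b$ iff $a=b$ or there is $c\in\mathfrak A$ such that $a\mathbin{\dot\sqcup}c$ is defined and equals $b$ (this is a partial order if $\mathfrak A$ is representable). A subset $S$ of $\mathfrak A$ is pairwise combinable if $s\mathbin{\dot\sqcup}t$ is defined for all $s\neq t\in S$. A representation $\theta$ is $\lesssim$-complete if for every pairwise-combinable subset $S$ of $\mathfrak A$ with a supremum $a$ with respect to $\lesssim$ we have $a^\theta=\bigcup_{s\in S}s^\theta$. $\mathfrak A$ is $\lesssim$-completely representable if it has a $\lesssim$-complete representation. Partial $(\dot\sqcup,0)$-algebras are viewed as structures for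 the first-order language $\mathcal L(J,0)$ (with equality), where $J$ is a ternary relation symbol and $J(a,b,c)$ holds iff $a\mathbin{\dot\sqcup}b$ is defined and equal to $c$. *)

theory Defs
  imports Main
begin

section \<open>Partial algebras of sets\<close>

definition dunion :: "'x set \<Rightarrow> 'x set \<Rightarrow> 'x set option" where
  "dunion S T = (if S \<inter> T = {} then Some (S \<union> T) else None)"

definition partial_algebra_of_sets :: "'x set \<Rightarrow> 'x set set \<Rightarrow> bool" where
  "partial_algebra_of_sets X F \<longleftrightarrow>
     F \<subseteq> Pow X \<and> {} \<in> F \<and> (\<forall>S\<in>F. \<forall>T\<in>F. \<forall>U. dunion S T = Some U \<longrightarrow> U \<in> F)"


section \<open>Abstract partial algebras and their representations\<close>

text \<open>The partial operation is an option-valued function; its values are only meaningful for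
  arguments in the carrier.\<close>

record 'a palgebra =
  elems :: "'a set"
  djoin :: "'a \<Rightarrow> 'a \<Rightarrow> 'a option"
  zero_elt :: 'a

definition partial_algebra :: "'a palgebra \<Rightarrow> bool" where
  "partial_algebra A \<longleftrightarrow>
     zero_elt A \<in> elems A \<and>
     (\<forall>a\<in>elems A. \<forall>b\<in>elems A. \<forall>c. djoin A a b = Some c \<longrightarrow> c \<in> elems A)"

definition representation :: "'a palgebra \<Rightarrow> 'x set \<Rightarrow> ('a \<Rightarrow> 'x set) \<Rightarrow> bool" where
  "representation A X \<theta> \<longleftrightarrow>
     (\<exists>F. partial_algebra_of_sets X F \<and> bij_betw \<theta> (elems A) F) \<and>
     \<theta> (zero_elt A) = {} \<and>
     (\<forall>a\<in>elems A. \<forall>b\<in>elems A.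
        (djoin A a b \<noteq> None \<longleftrightarrow> dunion (\<theta> a) (\<theta> b) \<noteq> None) \<and>
        (\<forall>c. djoin A a b = Some c \<longrightarrow> dunion (\<theta> a) (\<theta> b) = Some (\<theta> c)))"

definition lesssim :: "'a palgebra \<Rightarrow> 'a \<Rightarrow> 'a \<Rightarrow> bool" where
  "lesssim A a b \<longleftrightarrow> a = b \<or> (\<exists>c\<in>elems A. djoin A a c = Some b)"

definition pairwise_combinable :: "'a palgebra \<Rightarrow> 'a set \<Rightarrow> bool" where
  "pairwise_combinable A S \<longleftrightarrow>
     S \<subseteq> elems A \<and> (\<forall>s\<in>S. \<forall>t\<in>S. s \<noteq> t \<longrightarrow> djoin A s t \<noteq> None)"

definition is_supremum :: "'a palgebra \<Rightarrow> 'a set \<Rightarrow> 'a \<Rightarrow> bool" where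
  "is_supremum A S a \<longleftrightarrow>
     a \<in> elems A \<and> (\<forall>s\<in>S. lesssim A s a) \<and>
     (\<forall>b\<in>elems A. (\<forall>s\<in>S. lesssim A s b) \<longrightarrow> lesssim A a b)"

definition complete_representation :: "'a palgebra \<Rightarrow> 'x set \<Rightarrow> ('a \<Rightarrow> 'x set) \<Rightarrow> bool" where
  "complete_representation A X \<theta> \<longleftrightarrow>
     representation A X \<theta> \<and>
     (\<forall>S a. pairwise_combinable A S \<and> is_supremum A S a \<longrightarrow> \<theta> a = (\<Union>s\<in>S. \<theta> s))"

text \<open>A definition cannot quantify over the type of the base set. Taking base points to be
  sets of elements of the algebra loses no generality: see
  \<open>completely_representable_any_base\<close> below.\<close>

definition completely_representable :: "'a palgebra \<Rightarrow> bool" where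
  "completely_representable A \<longleftrightarrow>
     (\<exists>(X :: 'a set set) (\<theta> :: 'a \<Rightarrow> 'a set set). complete_representation A X \<theta>)"

lemma completely_representable_any_base:
  fixes A :: "'a palgebra" and X :: "'x set" and \<theta> :: "'a \<Rightarrow> 'x set"
  assumes pa: "partial_algebra A" and cr: "complete_representation A X \<theta>"
  shows "completely_representable A"
proof -
  define t where "t x = {a \<in> elems A. x \<in> \<theta> a}" for x
  define \<phi> where "\<phi> a = t ` \<theta> a" for a
  have t_mem: "t x \<in> \<phi> a \<longleftrightarrow> x \<in> \<theta> a" if "a \<in> elems A" for x a
    using that unfolding \<phi>_def t_def by blast
  have rep: "representation A X \<theta>"
    and cpl: "\<And>S a. pairwise_combinable A S \<Longrightarrow> is_supremum A S a \<Longrightarrow> \<theta> a = (\<Union>s\<in>S. \<theta> s)"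
    using cr by (auto simp: complete_representation_def)
  have inj: "inj_on \<theta> (elems A)" and z: "\<theta> (zero_elt A) = {}"
    using rep by (auto simp: representation_def bij_betw_def)
  have dj: "djoin A a b \<noteq> None \<longleftrightarrow> \<theta> a \<inter> \<theta> b = {}"
    and un: "djoin A a b = Some c \<Longrightarrow> \<theta> c = \<theta> a \<union> \<theta> b"
    if "a \<in> elems A" "b \<in> elems A" for a b c
  proof -
    have r: "(djoin A a b \<noteq> None \<longleftrightarrow> dunion (\<theta> a) (\<theta> b) \<noteq> None) \<and>
        (\<forall>c. djoin A a b = Some c \<longrightarrow> dunion (\<theta> a) (\<theta> b) = Some (\<theta> c))"
      using rep that(1,2) unfolding representation_def by blast
    show "djoin A a b \<noteq> None \<longleftrightarrow> \<theta> a \<inter> \<theta> b = {}"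
      using r by (auto simp: dunion_def)
    show "\<theta> c = \<theta> a \<union> \<theta> b" if "djoin A a b = Some c"
      using r that by (auto simp: dunion_def split: if_splits)
  qed
  have \<phi>_dj: "\<phi> a \<inter> \<phi> b = {} \<longleftrightarrow> \<theta> a \<inter> \<theta> b = {}" if "a \<in> elems A" "b \<in> elems A" for a b
    using that t_mem unfolding \<phi>_def by blast
  have inj': "inj_on \<phi> (elems A)"
  proof (rule inj_onI)
    fix a b assume ab: "a \<in> elems A" "b \<in> elems A" "\<phi> a = \<phi> b"
    have "\<theta> a = \<theta> b" using t_mem ab by blast
    then show "a = b" using inj ab by (auto dest: inj_onD)
  qed
  have z': "\<phi> (zero_elt A) = {}" using z by (simp add: \<phi>_def)
  have un': "\<phi> c = \<phi> a \<union> \<phi> b" if "a \<in> elems A" "b \<in> elems A" "djoin A a b = Some c" for a b c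
    using un[OF that] by (simp add: \<phi>_def image_Un)
  have dun: "(djoin A a b \<noteq> None \<longleftrightarrow> dunion (\<phi> a) (\<phi> b) \<noteq> None) \<and>
        (\<forall>c. djoin A a b = Some c \<longrightarrow> dunion (\<phi> a) (\<phi> b) = Some (\<phi> c))"
    if "a \<in> elems A" "b \<in> elems A" for a b
    using dj[OF that] \<phi>_dj[OF that] un'[OF that] by (auto simp: dunion_def)
  have "partial_algebra_of_sets UNIV (\<phi> ` elems A)"
    unfolding partial_algebra_of_sets_def
  proof (intro conjI ballI allI impI)
    show "{} \<in> \<phi> ` elems A" using z' pa unfolding partial_algebra_def by (metis imageI)
  next
    fix S T U assume "S \<in> \<phi> ` elems A" "T \<in> \<phi> ` elems A" and U: "dunion S T = Some U"
    then obtain a b where ab: "a \<in> elems A" "b \<in> elems A" "S = \<phi> a" "T = \<phi> b" by blast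
    then obtain c where "djoin A a b = Some c" using dun U by fastforce
    with ab U dun pa show "U \<in> \<phi> ` elems A"
      unfolding partial_algebra_def by (metis image_eqI option.inject)
  qed simp
  then have "representation A UNIV \<phi>"
    unfolding representation_def using inj' z' dun by (auto simp: bij_betw_def)
  moreover have "\<phi> a = (\<Union>s\<in>S. \<phi> s)" if "pairwise_combinable A S" "is_supremum A S a" for S a
    using cpl[OF that] by (simp add: \<phi>_def image_UN)
  ultimately show ?thesis
    unfolding completely_representable_def complete_representation_def by blast
qed


section \<open>The first-order language with a ternary relation symbol and a constant\<close>

datatype tm = Var nat | Zero

datatype fm =
    Eq tm tm
  | J tm tm tm
  | Neg fm
  | Conj fm fm
  | Forall nat fm

fun fv_tm :: "tm \<Rightarrow> nat set" where
  "fv_tm (Var n) = {n}"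
| "fv_tm Zero = {}"

fun fv :: "fm \<Rightarrow> nat set" where
  "fv (Eq s t) = fv_tm s \<union> fv_tm t"
| "fv (J s t u) = fv_tm s \<union> fv_tm t \<union> fv_tm u"
| "fv (Neg p) = fv p"
| "fv (Conj p q) = fv p \<union> fv q"
| "fv (Forall n p) = fv p - {n}"

definition sentence :: "fm \<Rightarrow> bool" where
  "sentence p \<longleftrightarrow> fv p = {}"

record 'a struct =
  domain :: "'a set"
  Jrel :: "'a \<Rightarrow> 'a \<Rightarrow> 'a \<Rightarrow> bool"
  const0 :: 'a

text \<open>The relation is required to hold only within the domain, so that two structures with the
  same domain, constant and interpretation of \<open>J\<close> on the domain are equal.\<close>

definition is_struct :: "'a struct \<Rightarrow> bool" where
  "is_struct M \<longleftrightarrow>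
     const0 M \<in> domain M \<and>
     (\<forall>a b c. Jrel M a b c \<longrightarrow> a \<in> domain M \<and> b \<in> domain M \<and> c \<in> domain M)"

fun eval_tm :: "'a struct \<Rightarrow> (nat \<Rightarrow> 'a) \<Rightarrow> tm \<Rightarrow> 'a" where
  "eval_tm M v (Var n) = v n"
| "eval_tm M v Zero = const0 M"

fun sat :: "'a struct \<Rightarrow> (nat \<Rightarrow> 'a) \<Rightarrow> fm \<Rightarrow> bool" where
  "sat M v (Eq s t) \<longleftrightarrow> eval_tm M v s = eval_tm M v t"
| "sat M v (J s t u) \<longleftrightarrow> Jrel M (eval_tm M v s) (eval_tm M v t) (eval_tm M v u)"
| "sat M v (Neg p) \<longleftrightarrow> \<not> sat M v p"
| "sat M v (Conj p q) \<longleftrightarrow> sat M v p \<and> sat M v q"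
| "sat M v (Forall n p) \<longleftrightarrow> (\<forall>a\<in>domain M. sat M (v(n := a)) p)"

definition models :: "'a struct \<Rightarrow> fm \<Rightarrow> bool" where
  "models M p \<longleftrightarrow> (\<forall>v. (\<forall>n. v n \<in> domain M) \<longrightarrow> sat M v p)"

definition elementarily_equivalent :: "'a struct \<Rightarrow> 'b struct \<Rightarrow> bool" where
  "elementarily_equivalent M N \<longleftrightarrow> (\<forall>p. sentence p \<longrightarrow> (models M p \<longleftrightarrow> models N p))"

definition closed_under_elementary_equivalence :: "'a struct set \<Rightarrow> bool" where
  "closed_under_elementary_equivalence K \<longleftrightarrow>
     (\<forall>M\<in>K. \<forall>N. is_struct N \<and> elementarily_equivalent M N \<longrightarrow> N \<in> K)"


section \<open>Partial algebras as structures\<close>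

definition struct_of :: "'a palgebra \<Rightarrow> 'a struct" where
  "struct_of A =
     \<lparr>domain = elems A,
      Jrel = (\<lambda>a b c. a \<in> elems A \<and> b \<in> elems A \<and> c \<in> elems A \<and> djoin A a b = Some c),
      const0 = zero_elt A\<rparr>"

definition completely_representable_structs :: "'a struct set" where
  "completely_representable_structs =
     {struct_of A | A. partial_algebra A \<and> completely_representable A}"

text \<open>Being the structure of a partial algebra is preserved by elementary equivalence, so closure
  of the class below can only fail through complete representability itself.\<close>

lemma struct_of_elementarily_equivalent:
  fixes A :: "'a palgebra" and N :: "'b struct"
  assumes N: "is_struct N" and eq: "elementarily_equivalent (struct_of A) N"
    and pa: "partial_algebra A"
  shows "\<exists>B. partial_algebra B \<and> struct_of B = N"
proof -
  define p where "p = Forall 0 (Forall 1 (Forall 2 (Forall 3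
    (Neg (Conj (J (Var 0) (Var 1) (Var 2))
       (Conj (J (Var 0) (Var 1) (Var 3)) (Neg (Eq (Var 2) (Var 3)))))))))"
  have "sentence p" by (auto simp: sentence_def p_def)
  moreover have "models (struct_of A) p"
    by (simp add: models_def p_def struct_of_def)
  ultimately have "models N p" using eq by (simp add: elementarily_equivalent_def)
  then have "sat N (\<lambda>_. const0 N) p" using N by (simp add: models_def is_struct_def)
  then have func: "Jrel N a b c \<Longrightarrow> Jrel N a b d \<Longrightarrow> c = d" for a b c d
    using N by (simp add: p_def is_struct_def) blast
  define B where "B = \<lparr>elems = domain N,
    djoin = (\<lambda>a b. if \<exists>c. Jrel N a b c then Some (THE c. Jrel N a b c) else None),
    zero_elt = const0 N\<rparr>"
  have dj: "djoin B a b = Some c \<longleftrightarrow> Jrel N a b c" for a b c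
    unfolding B_def using func by (auto intro: the_equality theI)
  have dom: "Jrel N a b c \<Longrightarrow> a \<in> domain N \<and> b \<in> domain N \<and> c \<in> domain N" for a b c
    using N by (auto simp: is_struct_def)
  have "partial_algebra B"
    using N dom by (auto simp: partial_algebra_def dj) (auto simp: B_def is_struct_def)
  moreover have "Jrel (struct_of B) = Jrel N"
    using dom by (intro ext) (auto simp: struct_of_def dj, auto simp: B_def)
  then have "struct_of B = N"
    by (simp add: struct_of_def B_def)
  ultimately show ?thesis by blast
qed

text \<open>HOL has no proper classes: the class consists of the structures whose elements are drawn
  from one ambient type. The statement uses \<^typ>\<open>nat set set\<close>, in which every set of cardinality
  at most that of the power set of the continuum has a copy. A pair of structures over this type
  witnessing non-closure also witnesses non-closure of the class of all structures, since
  representability does not depend on the type of the base set.\<close>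

end

theory Submission
  imports Defs "HOL-Combinatorics.Transposition"
begin

text \<open>For a set \<open>C\<close> of columns, consider the partial algebra generated by cells \<open>(i, j)\<close> with
  \<open>i \<in> \<nat>\<close> and \<open>j \<in> C\<close>, in which two cells are combinable iff they share a row or a column, and each
  row and each column has the unit as supremum. A point of a complete representation picks one cell
  in every row and every column, hence is a bijection from \<open>\<nat>\<close> to \<open>C\<close>: there is a complete
  representation when \<open>C\<close> is countably infinite and none when \<open>C\<close> is uncountable. First-order
  formulas do not see the difference, because permuting columns moves any finite set of columns
  into a given infinite one while fixing finitely many columns there.\<close>

section \<open>Satisfaction and isomorphism\<close>

lemma sat_cong:
  assumes "\<And>n. n \<in> fv p \<Longrightarrow> v n = w n"
  shows "sat M v p \<longleftrightarrow> sat M w p"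
  using assms
proof (induction p arbitrary: v w)
  case (Eq s t)
  have "eval_tm M v s = eval_tm M w s" "eval_tm M v t = eval_tm M w t"
    using Eq by (cases s; cases t; simp)+
  then show ?case by simp
next
  case (J s t u)
  have "eval_tm M v s = eval_tm M w s" using J by (cases s) simp_all
  moreover have "eval_tm M v t = eval_tm M w t" using J by (cases t) simp_all
  moreover have "eval_tm M v u = eval_tm M w u" using J by (cases u) simp_all
  ultimately show ?case by simp
next
  case (Neg p)
  have "sat M v p \<longleftrightarrow> sat M w p"
    using Neg.prems by (intro Neg.IH) simp
  then show ?case by simp
next
  case (Conj p q)
  have "sat M v p \<longleftrightarrow> sat M w p" "sat M v q \<longleftrightarrow> sat M w q"
    using Conj.prems by (auto intro!: Conj.IH)
  then show ?case by simp
next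
  case (Forall n p)
  have "sat M (v(n := a)) p \<longleftrightarrow> sat M (w(n := a)) p" for a
    using Forall.prems by (intro Forall.IH) auto
  then show ?case by simp
qed

text \<open>Assignments are irrelevant to a sentence, and the constant assignment to
  \<open>const0 M\<close> is an admissible one, so a single evaluation decides
  \<open>models\<close>.\<close>

lemma models_sentence:
  assumes "is_struct M" "sentence p"
  shows "models M p \<longleftrightarrow> sat M (\<lambda>_. const0 M) p"
proof -
  have "sat M v p \<longleftrightarrow> sat M (\<lambda>_. const0 M) p" for v
    using assms by (intro sat_cong) (simp add: sentence_def)
  then show ?thesis using assms by (auto simp: models_def is_struct_def)
qed

lemma finite_fv: "finite (fv p)"
proof -
  have "finite (fv_tm t)" for t by (cases t) auto
  then show ?thesis by (induction p) auto
qed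

definition struct_iso :: "('a \<Rightarrow> 'b) \<Rightarrow> 'a struct \<Rightarrow> 'b struct \<Rightarrow> bool" where
  "struct_iso h M N \<longleftrightarrow>
     bij_betw h (domain M) (domain N) \<and> h (const0 M) = const0 N \<and>
     (\<forall>a\<in>domain M. \<forall>b\<in>domain M. \<forall>c\<in>domain M. Jrel M a b c \<longleftrightarrow> Jrel N (h a) (h b) (h c))"

lemma struct_iso_inv:
  assumes "struct_iso h M N" "is_struct M"
  shows "struct_iso (inv_into (domain M) h) N M"
proof -
  let ?g = "inv_into (domain M) h"
  have bij: "bij_betw h (domain M) (domain N)" using assms by (simp add: struct_iso_def)
  then have inj: "inj_on h (domain M)" by (rule bij_betw_imp_inj_on)
  have g: "?g b \<in> domain M" "h (?g b) = b" if "b \<in> domain N" for b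
    using bij that by (auto simp: bij_betw_def f_inv_into_f inv_into_into)
  have "?g (const0 N) = const0 M"
    using assms inj by (metis inv_into_f_f is_struct_def struct_iso_def)
  then show ?thesis
    using assms(1) g bij_betw_inv_into[OF bij] by (simp add: struct_iso_def)
qed

text \<open>Injectivity of \<open>h\<close> settles equality; surjectivity onto
  \<open>domain N\<close> settles the quantifier.\<close>

lemma sat_iso:
  assumes iso: "struct_iso h M N" and M: "is_struct M" and v: "\<And>n. v n \<in> domain M"
  shows "sat M v p \<longleftrightarrow> sat N (h \<circ> v) p"
  using v
proof (induction p arbitrary: v)
  have zero: "const0 M \<in> domain M" "h (const0 M) = const0 N"
    using iso M by (auto simp only: is_struct_def struct_iso_def)
  have ev: "eval_tm M v t \<in> domain M" "eval_tm N (\<lambda>n. h (v n)) t = h (eval_tm M v t)"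
    if "\<And>n. v n \<in> domain M" for v t
    using that zero by (cases t; simp)+
  {
    case (Eq s t)
    have "inj_on h (domain M)" using iso by (simp add: struct_iso_def bij_betw_def)
    then show ?case using ev[of v] Eq by (simp add: inj_on_eq_iff comp_def)
  next
    case (J s t u)
    then show ?case using ev[of v] J iso by (simp add: struct_iso_def comp_def)
  next
    case (Forall n p)
    have "(h \<circ> v)(n := h a) = h \<circ> v(n := a)" for a by auto
    moreover have "sat M (v(n := a)) p \<longleftrightarrow> sat N (h \<circ> v(n := a)) p" if "a \<in> domain M" for a
      using Forall.prems that by (intro Forall.IH) simp
    moreover have "domain N = h ` domain M" using iso by (simp add: struct_iso_def bij_betw_def)
    ultimately show ?case by (simp add: comp_def)
  }
qed simp_all

lemma elementarily_equivalent_iso: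
  assumes "struct_iso h M N" "is_struct M" "is_struct N"
  shows "elementarily_equivalent M N"
proof -
  have "sat M (\<lambda>_. const0 M) p \<longleftrightarrow> sat N (\<lambda>_. const0 N) p" for p
    using sat_iso[OF assms(1,2), of "\<lambda>_. const0 M"] assms(1,2)
    unfolding is_struct_def struct_iso_def comp_def by metis
  then show ?thesis using assms by (simp add: elementarily_equivalent_def models_sentence)
qed

text \<open>A form of the Tarski--Vaught test: the automorphism moves any candidate witness into the
  substructure.\<close>

lemma elementarily_equivalent_substructure:
  assumes M: "is_struct M" and N: "is_struct N"
    and sub: "domain M \<subseteq> domain N" "const0 M = const0 N"
    and J: "\<And>a b c. \<lbrakk>a \<in> domain M; b \<in> domain M; c \<in> domain M\<rbrakk> \<Longrightarrow> Jrel M a b c \<longleftrightarrow> Jrel N a b c"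
    and auto: "\<And>P a. \<lbrakk>finite P; P \<subseteq> domain M; a \<in> domain N\<rbrakk> \<Longrightarrow>
      \<exists>h. struct_iso h N N \<and> (\<forall>x\<in>P. h x = x) \<and> h a \<in> domain M"
  shows "elementarily_equivalent M N"
proof -
  have "sat M v p \<longleftrightarrow> sat N v p" if "\<And>n. v n \<in> domain M" for v p
    using that
  proof (induction p arbitrary: v)
    have "const0 M \<in> domain M" using M unfolding is_struct_def by blast
    then have ev: "eval_tm M v t \<in> domain M" "eval_tm N v t = eval_tm M v t"
      if "\<And>n. v n \<in> domain M" for v t
      using that sub by (cases t; simp)+
    {
      case (Eq s t)
      then show ?case using ev[of v] Eq by simp
    next
      case (J s t u)
      then show ?case using ev[of v] J assms(5) by simp
    next
      case (Forall n p)
      have IH: "sat M (v(n := a)) p \<longleftrightarrow> sat N (v(n := a)) p" if "a \<in> domain M" for a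
        using Forall.prems that by (intro Forall.IH) simp
      have "sat N (v(n := a)) p" if all: "\<forall>a\<in>domain M. sat N (v(n := a)) p" and a: "a \<in> domain N" for a
      proof -
        \<comment> \<open>Only the values of the free variables of \<open>p\<close> are kept fixed,
          and these are finitely many. Elsewhere \<open>h \<circ> v\<close> may differ from
          \<open>v\<close>, which \<open>sat_cong\<close> disregards.\<close>
        obtain h where h: "struct_iso h N N" "\<forall>x\<in>v ` fv p. h x = x" "h a \<in> domain M"
          using auto[of "v ` fv p" a] finite_fv[of p] Forall.prems a by blast
        have "sat N (v(n := a)) p \<longleftrightarrow> sat N (h \<circ> v(n := a)) p"
          using Forall.prems sub a by (intro sat_iso[OF h(1) N]) auto
        also have "\<dots> \<longleftrightarrow> sat N (v(n := h a)) p"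
          using h(2) by (intro sat_cong) auto
        finally show ?thesis using all h(3) by simp
      qed
      then show ?case using IH sub by auto
    }
  qed simp_all
  moreover have "const0 M \<in> domain M" using M unfolding is_struct_def by blast
  ultimately show ?thesis
    using M N sub by (simp add: elementarily_equivalent_def models_sentence)
qed

section \<open>Complete representations pulled back along isomorphisms\<close>

lemma struct_of_simps [simp]:
  "domain (struct_of A) = elems A"
  "const0 (struct_of A) = zero_elt A"
  "Jrel (struct_of A) a b c \<longleftrightarrow> a \<in> elems A \<and> b \<in> elems A \<and> c \<in> elems A \<and> djoin A a b = Some c"
  by (simp_all add: struct_of_def)

lemma is_struct_struct_of: "partial_algebra A \<Longrightarrow> is_struct (struct_of A)"
  by (simp add: is_struct_def partial_algebra_def)

lemma complete_representation_iso:
  assumes iso: "struct_iso h (struct_of A) (struct_of B)"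
    and A: "partial_algebra A" and B: "partial_algebra B"
    and cr: "complete_representation B X \<theta>"
  shows "complete_representation A X (\<theta> \<circ> h)"
proof -
  have bij: "bij_betw h (elems A) (elems B)" and zero: "h (zero_elt A) = zero_elt B"
    using iso by (simp_all add: struct_iso_def)
  have mem: "h a \<in> elems B" if "a \<in> elems A" for a using bij that by (auto simp: bij_betw_def)
  have img: "elems B = h ` elems A" and inj: "inj_on h (elems A)"
    using bij by (auto simp: bij_betw_def)
  have dj_iff: "djoin A a b = Some c \<longleftrightarrow> djoin B (h a) (h b) = Some (h c)"
    if "a \<in> elems A" "b \<in> elems A" "c \<in> elems A" for a b c
    using iso that mem by (simp add: struct_iso_def)
  \<comment> \<open>The isomorphism relates only the graphs of the two operations on the carriers.
    Definedness transfers as well, because a value of \<open>djoin B\<close> on the carrier lies in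
    the carrier and hence in the image of \<open>h\<close>.\<close>
  have dj: "djoin B (h a) (h b) = map_option h (djoin A a b)"
    if "a \<in> elems A" "b \<in> elems A" for a b
  proof (cases "djoin A a b")
    case None
    then show ?thesis
      using that dj_iff[OF that] mem B img unfolding partial_algebra_def
      by (metis (no_types, lifting) imageE not_Some_eq option.map_disc_iff)
  next
    case (Some c)
    then have "c \<in> elems A" using A that unfolding partial_algebra_def by blast
    then show ?thesis using dj_iff[OF that, of c] Some by simp
  qed
  have le: "lesssim A a b \<longleftrightarrow> lesssim B (h a) (h b)" if "a \<in> elems A" "b \<in> elems A" for a b
    using dj_iff[OF that(1) _ that(2)] inj_on_eq_iff[OF inj that] unfolding lesssim_def img by blast
  have "representation A X (\<theta> \<circ> h)"
  proof -
    have rep: "representation B X \<theta>" using cr by (simp add: complete_representation_def)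
    then obtain F where "partial_algebra_of_sets X F" "bij_betw \<theta> (elems B) F"
      by (auto simp: representation_def)
    then have "\<exists>F. partial_algebra_of_sets X F \<and> bij_betw (\<theta> \<circ> h) (elems A) F"
      using bij_betw_trans[OF bij] by blast
    moreover have "(djoin A a b \<noteq> None \<longleftrightarrow> dunion (\<theta> (h a)) (\<theta> (h b)) \<noteq> None) \<and>
        (\<forall>c. djoin A a b = Some c \<longrightarrow> dunion (\<theta> (h a)) (\<theta> (h b)) = Some (\<theta> (h c)))"
      if "a \<in> elems A" "b \<in> elems A" for a b
    proof -
      have "(djoin B (h a) (h b) \<noteq> None \<longleftrightarrow> dunion (\<theta> (h a)) (\<theta> (h b)) \<noteq> None) \<and>
          (\<forall>c. djoin B (h a) (h b) = Some c \<longrightarrow> dunion (\<theta> (h a)) (\<theta> (h b)) = Some (\<theta> c))"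
        using rep mem[OF that(1)] mem[OF that(2)] unfolding representation_def by blast
      then show ?thesis using dj[OF that] by (cases "djoin A a b") simp_all
    qed
    moreover have "\<theta> (zero_elt B) = {}" using rep by (simp add: representation_def)
    ultimately show ?thesis unfolding representation_def comp_apply zero by blast
  qed
  moreover have "(\<theta> \<circ> h) a = (\<Union>s\<in>S. (\<theta> \<circ> h) s)"
    if S: "pairwise_combinable A S" and a: "is_supremum A S a" for S a
  proof -
    have sub: "S \<subseteq> elems A" using S by (simp add: pairwise_combinable_def)
    have "pairwise_combinable B (h ` S)"
      unfolding pairwise_combinable_def
    proof (intro conjI ballI impI)
      show "h ` S \<subseteq> elems B" using sub img by auto
      fix s t assume "s \<in> h ` S" "t \<in> h ` S" "s \<noteq> t"
      then obtain s' t' where st: "s' \<in> S" "t' \<in> S" "s' \<noteq> t'" "s = h s'" "t = h t'" by auto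
      then have "djoin A s' t' \<noteq> None" using S unfolding pairwise_combinable_def by blast
      then show "djoin B s t \<noteq> None"
        using st dj[OF subsetD[OF sub st(1)] subsetD[OF sub st(2)]] by simp
    qed
    moreover have "is_supremum B (h ` S) (h a)"
      using a sub le unfolding is_supremum_def img by (auto simp: subset_iff)
    ultimately have "\<theta> (h a) = (\<Union>s\<in>h ` S. \<theta> s)"
      using cr unfolding complete_representation_def by blast
    then show ?thesis by simp
  qed
  ultimately show ?thesis by (simp add: complete_representation_def)
qed


section \<open>The grid algebras\<close>

definition axial :: "('i \<times> 'j) set \<Rightarrow> bool" where
  "axial S \<longleftrightarrow> (\<forall>p\<in>S. \<forall>q\<in>S. fst p = fst q) \<or> (\<forall>p\<in>S. \<forall>q\<in>S. snd p = snd q)"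

definition collinear :: "'i \<times> 'j \<Rightarrow> 'i \<times> 'j \<Rightarrow> bool" where
  "collinear p q \<longleftrightarrow> fst p = fst q \<or> snd p = snd q"

text \<open>Two collinear cells in different rows share a column, and a cell off that column would
  have to share a row with both. So pairwise collinearity forces one common row or one common
  column.\<close>

lemma axial_iff_collinear: "axial S \<longleftrightarrow> (\<forall>p\<in>S. \<forall>q\<in>S. collinear p q)"
proof
  assume c: "\<forall>p\<in>S. \<forall>q\<in>S. collinear p q"
  show "axial S"
  proof (rule ccontr)
    assume "\<not> axial S"
    then obtain p q r s where "p \<in> S" "q \<in> S" "r \<in> S" "s \<in> S" "fst p \<noteq> fst q" "snd r \<noteq> snd s"
      unfolding axial_def by blast
    then show False using c unfolding collinear_def by metis
  qed
qed (auto simp: axial_def collinear_def)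

lemma axial_subset: "axial T \<Longrightarrow> S \<subseteq> T \<Longrightarrow> axial S"
  unfolding axial_def by blast

lemma axial_simps [simp]: "axial {}" "axial {p}"
  by (auto simp: axial_def)

lemma axial_Un:
  assumes "axial F" "axial G" and "\<And>p q. p \<in> F \<Longrightarrow> q \<in> G \<Longrightarrow> collinear p q"
  shows "axial (F \<union> G)"
  using assms by (auto simp: axial_iff_collinear collinear_def) metis+

text \<open>A cell \<open>(i, j)\<close> stands for the condition \<open>f i = j\<close> on a bijection \<open>f\<close>: \<open>Pos F\<close> says that \<open>f\<close>
  meets one of the conditions in \<open>F\<close>, and \<open>Neg F\<close> that it meets none.\<close>

datatype 'j elt = Pos "(nat \<times> 'j) set" | Neg "(nat \<times> 'j) set"

fun cells :: "'j elt \<Rightarrow> (nat \<times> 'j) set" where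
  "cells (Pos F) = F"
| "cells (Neg F) = F"

text \<open>The clauses copy disjoint union of the sets of bijections that the elements stand for.
  Two \<open>Pos\<close> are disjoint if no bijection satisfies a condition from each; two
  \<open>Neg\<close> never are, as finitely many conditions can be avoided at once. Since an axial
  \<open>G\<close> is met in at most one cell, meeting \<open>F\<close> or missing \<open>G\<close>
  amounts to missing \<open>G - F\<close>.\<close>

fun elt_join :: "'j elt \<Rightarrow> 'j elt \<Rightarrow> 'j elt option" where
  "elt_join (Pos F) (Pos G) = (if F \<inter> G = {} \<and> axial (F \<union> G) then Some (Pos (F \<union> G)) else None)"
| "elt_join (Pos F) (Neg G) = (if F \<subseteq> G then Some (Neg (G - F)) else None)"
| "elt_join (Neg G) (Pos F) = (if F \<subseteq> G then Some (Neg (G - F)) else None)"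
| "elt_join (Neg F) (Neg G) = None"

text \<open>Finiteness of \<open>cells\<close> lets a column permutation move any element into the
  grid over an infinite \<open>C\<close>, and it excludes whole columns, so that only the unit
  \<open>Neg {}\<close> bounds all cells of a column. Axiality makes the conditions of one element
  mutually exclusive.\<close>

definition grid :: "'j set \<Rightarrow> 'j elt palgebra" where
  "grid C = \<lparr>elems = {a. finite (cells a) \<and> axial (cells a) \<and> snd ` cells a \<subseteq> C},
             djoin = elt_join, zero_elt = Pos {}\<rparr>"

lemma grid_simps [simp]:
  "a \<in> elems (grid C) \<longleftrightarrow> finite (cells a) \<and> axial (cells a) \<and> snd ` cells a \<subseteq> C"
  "djoin (grid C) = elt_join"
  "zero_elt (grid C) = Pos {}"
  by (simp_all add: grid_def)

lemma partial_algebra_grid: "partial_algebra (grid C)"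
proof -
  have "c \<in> elems (grid C)"
    if ab: "a \<in> elems (grid C)" "b \<in> elems (grid C)" and c: "elt_join a b = Some c" for a b c
  proof -
    have "cells c \<subseteq> cells a \<union> cells b" "axial (cells c)"
      using ab c by (cases a; cases b; auto split: if_splits elim: axial_subset)+
    moreover have "snd ` (cells a \<union> cells b) \<subseteq> C" using ab by (simp add: image_Un)
    ultimately show ?thesis using ab by (auto intro: finite_subset)
  qed
  moreover have "zero_elt (grid C) \<in> elems (grid C)" by simp
  ultimately show ?thesis unfolding partial_algebra_def grid_simps(2) by blast
qed

text \<open>The missing summand is explicit in the three positive cases: \<open>Pos (G - F)\<close>,
  \<open>Neg (F \<union> G)\<close> and \<open>Pos (F - G)\<close>. The second lies in the carrier
  exactly when \<open>F \<union> G\<close> is axial. A defined join with a \<open>Neg\<close> is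
  always a \<open>Neg\<close>, which rules out the remaining case.\<close>

lemma lesssim_grid:
  fixes C :: "'j set"
  shows "\<lbrakk>Pos F \<in> elems (grid C); Pos G \<in> elems (grid C)\<rbrakk> \<Longrightarrow>
           lesssim (grid C) (Pos F) (Pos G) \<longleftrightarrow> F \<subseteq> G" (is "\<lbrakk>_; _\<rbrakk> \<Longrightarrow> ?PP")
    and "\<lbrakk>Pos F \<in> elems (grid C); Neg G \<in> elems (grid C)\<rbrakk> \<Longrightarrow>
           lesssim (grid C) (Pos F) (Neg G) \<longleftrightarrow> F \<inter> G = {} \<and> axial (F \<union> G)" (is "\<lbrakk>_; _\<rbrakk> \<Longrightarrow> ?PN")
    and "\<not> lesssim (grid C) (Neg F) (Pos G)"
    and "\<lbrakk>Neg F \<in> elems (grid C); Neg G \<in> elems (grid C)\<rbrakk> \<Longrightarrow>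
           lesssim (grid C) (Neg F) (Neg G) \<longleftrightarrow> G \<subseteq> F" (is "\<lbrakk>_; _\<rbrakk> \<Longrightarrow> ?NN")
proof -
  have some: "lesssim (grid C) a b \<longleftrightarrow> a = b \<or> (\<exists>H. Pos H \<in> elems (grid C) \<and> elt_join a (Pos H) = Some b)
     \<or> (\<exists>H. Neg H \<in> elems (grid C) \<and> elt_join a (Neg H) = Some b)" for a b
    unfolding lesssim_def grid_simps(2) by (metis elt.exhaust)
  show "\<not> lesssim (grid C) (Neg F) (Pos G)" by (auto simp: some split: if_splits)
  {
    assume a: "Pos F \<in> elems (grid C)" "Pos G \<in> elems (grid C)"
    show ?PP
    proof
      assume "F \<subseteq> G"
      then have "Pos (G - F) \<in> elems (grid C)" "elt_join (Pos F) (Pos (G - F)) = Some (Pos G)"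
        using a by (auto elim: axial_subset simp: Un_absorb1)
      then show "lesssim (grid C) (Pos F) (Pos G)" unfolding some by blast
    qed (auto simp: some split: if_splits)
  next
    assume a: "Pos F \<in> elems (grid C)" "Neg G \<in> elems (grid C)"
    show ?PN
    proof
      assume "F \<inter> G = {} \<and> axial (F \<union> G)"
      then have "Neg (F \<union> G) \<in> elems (grid C)" "elt_join (Pos F) (Neg (F \<union> G)) = Some (Neg G)"
        using a by auto
      then show "lesssim (grid C) (Pos F) (Neg G)" unfolding some by blast
    qed (auto simp: some Un_absorb1 split: if_splits)
  next
    assume a: "Neg F \<in> elems (grid C)" "Neg G \<in> elems (grid C)"
    show ?NN
    proof
      assume "G \<subseteq> F"
      then have "Pos (F - G) \<in> elems (grid C)" "elt_join (Neg F) (Pos (F - G)) = Some (Neg G)"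
        using a by (auto elim: axial_subset)
      then show "lesssim (grid C) (Neg F) (Neg G)" unfolding some by blast
    qed (auto simp: some split: if_splits)
  }
qed


section \<open>Elementary equivalence of infinite grids\<close>

text \<open>The elements of \<open>D\<close> are treated one at a time: an image outside
  \<open>C\<close> is swapped with a fresh element of \<open>C\<close>.\<close>

lemma permutation_into_infinite_set:
  assumes C: "infinite C" and P: "finite P" "P \<subseteq> C" and D: "finite D"
  shows "\<exists>\<pi>. bij \<pi> \<and> (\<forall>x\<in>P. \<pi> x = x) \<and> \<pi> ` D \<subseteq> C"
  using D
proof induction
  case empty
  show ?case using bij_id by (intro exI[of _ "\<lambda>x. x"]) (simp add: id_def)
next
  case (insert d D)
  then obtain \<pi> where \<pi>: "bij \<pi>" "\<forall>x\<in>P. \<pi> x = x" "\<pi> ` D \<subseteq> C" by blast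
  show ?case
  proof (cases "\<pi> d \<in> C")
    case True
    then show ?thesis using \<pi> by blast
  next
    case False
    have "infinite (C - (P \<union> \<pi> ` D))" using C P insert.hyps by auto
    then obtain c where c: "c \<in> C" "c \<notin> P" "c \<notin> \<pi> ` D"
      by (metis Diff_iff UnI1 UnI2 ex_in_conv finite.emptyI)
    let ?\<tau> = "transpose (\<pi> d) c \<circ> \<pi>"
    \<comment> \<open>Both \<open>P\<close> and the images placed so far lie in \<open>C\<close> and
      avoid \<open>c\<close>, whereas \<open>\<pi> d\<close> is outside \<open>C\<close>; the swap
      therefore disturbs none of them.\<close>
    have fix_: "transpose (\<pi> d) c x = x" if "x \<in> P \<union> \<pi> ` D" for x
      using that c False P \<pi>(3) by (intro transpose_apply_other) auto
    have "bij ?\<tau>" using \<pi>(1) by (simp add: bij_comp)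
    moreover have "\<forall>x\<in>P. ?\<tau> x = x" using fix_ \<pi>(2) by simp
    moreover have "?\<tau> ` insert d D \<subseteq> C" using fix_ \<pi>(3) c by auto
    ultimately show ?thesis by blast
  qed
qed

section \<open>Column permutations as automorphisms of the full grid\<close>

fun permute_columns :: "('j \<Rightarrow> 'j) \<Rightarrow> 'j elt \<Rightarrow> 'j elt" where
  "permute_columns \<pi> (Pos F) = Pos (map_prod id \<pi> ` F)"
| "permute_columns \<pi> (Neg F) = Neg (map_prod id \<pi> ` F)"

lemma struct_iso_permute_columns:
  assumes \<pi>: "bij \<pi>"
  shows "struct_iso (permute_columns \<pi>) (struct_of (grid UNIV)) (struct_of (grid UNIV))"
proof -
  let ?h = "map_prod id \<pi> :: nat \<times> 'a \<Rightarrow> _"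
  have bij: "bij ?h" using \<pi> by (metis bij_id bij_betw_map_prod UNIV_Times_UNIV)
  then have inj: "inj ?h" by (rule bij_is_inj)
  have ax: "axial (?h ` F) \<longleftrightarrow> axial F" for F
    using \<pi> by (simp add: axial_def bij_is_inj inj_eq)
  have perm_inj: "permute_columns \<pi> a = permute_columns \<pi> b \<longleftrightarrow> a = b" for a b
    by (cases a; cases b) (simp_all add: inj_image_eq_iff[OF inj])
  have cells_perm: "cells (permute_columns \<pi> a) = ?h ` cells a" for a
    by (cases a) simp_all
  have mem: "permute_columns \<pi> a \<in> elems (grid UNIV) \<longleftrightarrow> a \<in> elems (grid UNIV)" for a
    using inj by (simp add: cells_perm ax finite_image_iff inj_on_subset)
  have surj: "\<exists>b. a = permute_columns \<pi> b" for a
  proof (cases a)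
    case (Pos F)
    then have "a = permute_columns \<pi> (Pos (?h -` F))"
      using bij by (simp add: bij_is_surj surj_image_vimage_eq)
    then show ?thesis ..
  next
    case (Neg F)
    then have "a = permute_columns \<pi> (Neg (?h -` F))"
      using bij by (simp add: bij_is_surj surj_image_vimage_eq)
    then show ?thesis ..
  qed
  have "bij_betw (permute_columns \<pi>) (elems (grid UNIV)) (elems (grid UNIV))"
    using perm_inj mem surj by (intro bij_betwI') metis+
  moreover
  have "?h ` F \<inter> ?h ` G = {} \<longleftrightarrow> F \<inter> G = {}" "axial (?h ` F \<union> ?h ` G) \<longleftrightarrow> axial (F \<union> G)"
    "?h ` F \<subseteq> ?h ` G \<longleftrightarrow> F \<subseteq> G" "?h ` (G - F) = ?h ` G - ?h ` F" for F G
    by (simp_all only: ax image_is_empty inj_image_subset_iff[OF inj] image_set_diff[OF inj]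
        flip: image_Un image_Int[OF inj])
  then have "elt_join (permute_columns \<pi> a) (permute_columns \<pi> b)
      = map_option (permute_columns \<pi>) (elt_join a b)" for a b
    by (cases a; cases b) (simp_all add: image_Un)
  then have "elt_join (permute_columns \<pi> a) (permute_columns \<pi> b) = Some (permute_columns \<pi> c)
      \<longleftrightarrow> elt_join a b = Some c" for a b c
    using perm_inj by auto
  ultimately show ?thesis
    using mem unfolding struct_iso_def by simp
qed

text \<open>The parameters in \<open>P\<close> mention finitely many columns, all in
  \<open>C\<close>. A column permutation that fixes these and moves the finitely many columns of
  \<open>a\<close> into \<open>C\<close> induces the automorphism required by the substructure
  test.\<close>

lemma elementarily_equivalent_grid:
  fixes C :: "'j set"
  assumes C: "infinite C"
  shows "elementarily_equivalent (struct_of (grid C)) (struct_of (grid (UNIV :: 'j set)))"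
proof (rule elementarily_equivalent_substructure)
  show "is_struct (struct_of (grid C))" "is_struct (struct_of (grid UNIV))"
    by (intro is_struct_struct_of partial_algebra_grid)+
  fix P a
  assume P: "finite P" "P \<subseteq> domain (struct_of (grid C))" and a: "a \<in> domain (struct_of (grid (UNIV :: 'j set)))"
  have "finite (cells x)" "snd ` cells x \<subseteq> C" if "x \<in> P" for x
    using subsetD[OF P(2) that] by simp_all
  then have "finite (snd ` \<Union>(cells ` P))" "snd ` \<Union>(cells ` P) \<subseteq> C" "finite (snd ` cells a)"
    using P(1) a by (auto simp: image_UN)
  from permutation_into_infinite_set[OF C this]
  obtain \<pi> where \<pi>: "bij \<pi>" "\<forall>x\<in>snd ` \<Union>(cells ` P). \<pi> x = x" "\<pi> ` snd ` cells a \<subseteq> C"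
    by blast
  have iso: "struct_iso (permute_columns \<pi>) (struct_of (grid UNIV)) (struct_of (grid UNIV))"
    by (rule struct_iso_permute_columns[OF \<pi>(1)])
  moreover have "\<forall>x\<in>P. permute_columns \<pi> x = x"
  proof
    fix x assume x: "x \<in> P"
    have "map_prod id \<pi> ` cells x = (\<lambda>p. p) ` cells x"
    proof (rule image_cong[OF refl])
      fix p assume "p \<in> cells x"
      then have "\<pi> (snd p) = snd p" using \<pi>(2) x by blast
      then show "map_prod id \<pi> p = p" by (simp add: prod_eq_iff)
    qed
    then show "permute_columns \<pi> x = x" by (cases x) simp_all
  qed
  moreover have "permute_columns \<pi> a \<in> elems (grid C)"
  proof -
    have "permute_columns \<pi> a \<in> elems (grid UNIV)"
      using iso a by (auto simp: struct_iso_def bij_betw_def simp del: grid_simps)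
    moreover have "snd ` cells (permute_columns \<pi> a) \<subseteq> C"
      using \<pi>(3) by (cases a) force+
    ultimately show ?thesis by simp
  qed
  ultimately show "\<exists>h. struct_iso h (struct_of (grid UNIV)) (struct_of (grid UNIV)) \<and>
      (\<forall>x\<in>P. h x = x) \<and> h a \<in> domain (struct_of (grid C))"
    by auto
qed auto


section \<open>Complete representability\<close>

text \<open>With \<open>N\<close> above every coordinate involved, \<open>g\<close> swaps the blocks
  \<open>{0..<N}\<close> and \<open>{N..<2*N}\<close>. An argument below \<open>N\<close> then gets
  a value of at least \<open>N\<close>, so the graph of \<open>g\<close> misses
  \<open>G\<close>.\<close>

lemma nat_permutation_avoiding:
  fixes G :: "(nat \<times> nat) set"
  assumes G: "finite G" and ij: "(i, j) \<notin> G"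
  shows "\<exists>f. bij f \<and> f i = j \<and> (\<forall>k. (k, f k) \<notin> G)"
proof -
  have "finite (insert i (insert j (fst ` G \<union> snd ` G)))" using G by simp
  then obtain N where N: "\<forall>n \<in> insert i (insert j (fst ` G \<union> snd ` G)). n < N"
    by (metis finite_nat_set_iff_bounded)
  then have iN: "i < N" and jN: "j < N" and GN: "\<And>a b. (a, b) \<in> G \<Longrightarrow> a < N \<and> b < N"
    by force+
  define g where "g k = (if k < N then k + N else if k < 2 * N then k - N else k)" for k
  have "g (g k) = k" for k by (auto simp: g_def)
  then have "bij g" by (intro involuntory_imp_bij)
  \<comment> \<open>As \<open>g (j + N) = j\<close>, the transposition makes \<open>i\<close> go to
    \<open>j\<close>. The only other changed value is at \<open>j + N\<close>, a row in which
    \<open>G\<close> has no cell.\<close>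
  let ?f = "g \<circ> transpose i (j + N)"
  have "bij ?f" using \<open>bij g\<close> by (simp add: bij_comp)
  moreover have "?f i = j" using jN by (simp add: g_def)
  moreover have "(k, ?f k) \<notin> G" for k
    using ij iN jN by (auto dest!: GN simp: g_def transpose_def split: if_splits)
  ultimately show ?thesis by blast
qed

section \<open>Bijections onto a countably infinite set of columns\<close>

context
  fixes C :: "'j set" and e :: "nat \<Rightarrow> 'j"
  assumes e: "bij_betw e UNIV C"
begin

lemma bijection_avoiding:
  fixes G :: "(nat \<times> 'j) set"
  assumes G: "finite G" and j: "j \<in> C" and ij: "(i, j) \<notin> G"
  shows "\<exists>f. bij_betw f UNIV C \<and> f i = j \<and> (\<forall>k. (k, f k) \<notin> G)"
proof -
  have "inj (map_prod id e :: nat \<times> nat \<Rightarrow> _)"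
    using e by (simp add: bij_betw_def prod.inj_map)
  then have "finite (map_prod id e -` G)" using G by (intro finite_vimageI)
  moreover obtain j' where j': "j = e j'" using e j by (auto simp: bij_betw_def)
  ultimately obtain f where f: "bij f" "f i = j'" "\<forall>k. (k, f k) \<notin> map_prod id e -` G"
    using nat_permutation_avoiding[of "map_prod id e -` G" i j'] ij by auto
  show ?thesis
    using f j' bij_betw_trans[OF f(1) e] by (intro exI[of _ "e \<circ> f"]) simp
qed

lemma bijection_through_two:
  fixes i i' :: nat
  assumes "i \<noteq> i'" "j \<noteq> j'" "j \<in> C" "j' \<in> C"
  shows "\<exists>f. bij_betw f UNIV C \<and> f i = j \<and> f i' = j'"
proof -
  obtain a b where ab: "j = e a" "j' = e b" "a \<noteq> b" using e assms by (auto simp: bij_betw_def)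
  \<comment> \<open>The inner transposition sends \<open>i\<close> to \<open>a\<close>. The outer
    one redirects the value at \<open>i'\<close> to \<open>b\<close> and leaves \<open>a\<close>
    alone, since \<open>a\<close> is neither that value nor \<open>b\<close>.\<close>
  let ?f = "transpose (transpose i a i') b \<circ> transpose i a"
  have "transpose i a i' \<noteq> a" using assms(1) by (metis transpose_apply_first transpose_eq_iff)
  then have "?f i = a" "?f i' = b" using ab by simp_all
  moreover have "bij_betw (e \<circ> ?f) UNIV C" by (rule bij_betw_trans[OF _ e]) (simp add: bij_comp)
  ultimately show ?thesis using ab by (intro exI[of _ "e \<circ> ?f"]) simp
qed

section \<open>The representation by sets of bijections\<close>

definition meets :: "(nat \<Rightarrow> 'j) \<Rightarrow> (nat \<times> 'j) set \<Rightarrow> bool" where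
  "meets f F \<longleftrightarrow> (\<exists>k. (k, f k) \<in> F)"

fun bijections_of :: "'j elt \<Rightarrow> (nat \<Rightarrow> 'j) set" where
  "bijections_of (Pos F) = {f. bij_betw f UNIV C \<and> meets f F}"
| "bijections_of (Neg F) = {f. bij_betw f UNIV C \<and> \<not> meets f F}"

lemma meets_Un: "meets f (F \<union> G) \<longleftrightarrow> meets f F \<or> meets f G"
  by (auto simp: meets_def)

text \<open>The column \<open>e 0\<close> is infinite, so it has a cell outside \<open>G\<close>
  through which an avoiding bijection can be drawn.\<close>

lemma ex_not_meets:
  assumes "finite G"
  shows "\<exists>f. bij_betw f UNIV C \<and> \<not> meets f G"
proof -
  have "infinite (range (\<lambda>i::nat. (i, e 0)))" by (simp add: finite_image_iff inj_on_def)
  then obtain i where "(i, e 0) \<notin> G" using assms by (metis finite_subset image_subsetI)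
  moreover have "e 0 \<in> C" using e by (auto simp: bij_betw_def)
  ultimately show ?thesis using bijection_avoiding[OF assms] unfolding meets_def by metis
qed

text \<open>A cell of \<open>F\<close> outside the finite \<open>G\<close> lies on the graph of a
  bijection that avoids \<open>G\<close>. This serves both the injectivity of the representation and
  the definedness of a join of a \<open>Pos\<close> with a \<open>Neg\<close>.\<close>

lemma meets_mono_iff:
  assumes "finite G" "snd ` F \<subseteq> C"
  shows "(\<forall>f. bij_betw f UNIV C \<longrightarrow> meets f F \<longrightarrow> meets f G) \<longleftrightarrow> F \<subseteq> G"
proof (intro iffI subsetI)
  fix p assume all: "\<forall>f. bij_betw f UNIV C \<longrightarrow> meets f F \<longrightarrow> meets f G" and p: "p \<in> F"
  show "p \<in> G"
  proof (rule ccontr)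
    assume "p \<notin> G"
    then obtain f where "bij_betw f UNIV C" "f (fst p) = snd p" "\<forall>k. (k, f k) \<notin> G"
      using bijection_avoiding[of G "snd p" "fst p"] assms p by auto
    then show False using all p by (metis meets_def prod.collapse)
  qed
qed (auto simp: meets_def)

text \<open>A common cell, or two cells that are not collinear, lie on the graph of one bijection.
  Conversely, the graph of a bijection contains no two distinct collinear cells.\<close>

lemma meets_disjoint_iff:
  assumes F: "axial F" "snd ` F \<subseteq> C" and G: "axial G" "snd ` G \<subseteq> C"
  shows "(\<forall>f. bij_betw f UNIV C \<longrightarrow> \<not> (meets f F \<and> meets f G)) \<longleftrightarrow> F \<inter> G = {} \<and> axial (F \<union> G)"
proof (intro iffI conjI)
  assume all: "\<forall>f. bij_betw f UNIV C \<longrightarrow> \<not> (meets f F \<and> meets f G)"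
  show "F \<inter> G = {}"
  proof (rule ccontr)
    assume "F \<inter> G \<noteq> {}"
    then obtain i j where p: "(i, j) \<in> F" "(i, j) \<in> G" by auto
    then obtain f where "bij_betw f UNIV C" "f i = j"
      using bijection_avoiding[of "{}" j i] F(2) p(1) by fastforce
    then show False using all p unfolding meets_def by metis
  qed
  show "axial (F \<union> G)"
  proof (rule axial_Un[OF F(1) G(1)], rule ccontr)
    fix p q assume pq: "p \<in> F" "q \<in> G" "\<not> collinear p q"
    then obtain f where "bij_betw f UNIV C" "f (fst p) = snd p" "f (fst q) = snd q"
      using bijection_through_two[of "fst p" "fst q" "snd p" "snd q"] F G
      by (auto simp: collinear_def)
    then show False using all pq by (metis meets_def prod.collapse)
  qed
next
  assume FG: "F \<inter> G = {} \<and> axial (F \<union> G)"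
  show "\<forall>f. bij_betw f UNIV C \<longrightarrow> \<not> (meets f F \<and> meets f G)"
  proof (intro allI impI notI)
    fix f assume f: "bij_betw f UNIV C" and "meets f F \<and> meets f G"
    then obtain k l where kl: "(k, f k) \<in> F" "(l, f l) \<in> G" by (auto simp: meets_def)
    then have "k = l \<or> f k = f l"
      using FG unfolding axial_iff_collinear collinear_def by (metis UnI1 UnI2 fst_conv snd_conv)
    then have "k = l" using f by (auto simp: bij_betw_def dest: injD)
    then show False using FG kl by blast
  qed
qed

lemma representation_grid: "representation (grid C) UNIV bijections_of"
proof -
  have inj: "inj_on bijections_of (elems (grid C))"
  proof (rule inj_onI)
    fix a b assume ab: "a \<in> elems (grid C)" "b \<in> elems (grid C)" "bijections_of a = bijections_of b"
    \<comment> \<open>A bijection avoiding \<open>F \<union> G\<close> belongs to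
      \<open>Neg G\<close> but not to \<open>Pos F\<close>.\<close>
    have PN: False if "finite F" "finite G" "bijections_of (Pos F) = bijections_of (Neg G)" for F G
      using ex_not_meets[of "F \<union> G"] that by (auto simp: meets_Un)
    have eq: "F = G"
      if "finite F" "finite G" "snd ` F \<subseteq> C" "snd ` G \<subseteq> C"
        "\<And>f. bij_betw f UNIV C \<Longrightarrow> meets f F \<longleftrightarrow> meets f G" for F G
      using that meets_mono_iff[of F G] meets_mono_iff[of G F] by blast
    show "a = b"
    proof (cases a; cases b)
      fix F G assume "a = Pos F" "b = Pos G"
      then show ?thesis using ab eq[of F G] by (simp add: set_eq_iff) blast
    next
      fix F G assume "a = Neg F" "b = Neg G"
      then show ?thesis using ab eq[of F G] by (simp add: set_eq_iff) blast
    qed (use ab PN in \<open>metis cells.simps grid_simps(1)\<close>)+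
  qed
  have dj: "elt_join a b \<noteq> None \<longleftrightarrow> bijections_of a \<inter> bijections_of b = {}"
    and un: "\<And>c. elt_join a b = Some c \<Longrightarrow> bijections_of c = bijections_of a \<union> bijections_of b"
    if a: "a \<in> elems (grid C)" and b: "b \<in> elems (grid C)" for a b
  proof -
    have PN: "F \<subseteq> G \<longleftrightarrow> bijections_of (Pos F) \<inter> bijections_of (Neg G) = {}"
      if "finite G" "snd ` F \<subseteq> C" for F G
      using meets_mono_iff[OF that] by auto
    show "elt_join a b \<noteq> None \<longleftrightarrow> bijections_of a \<inter> bijections_of b = {}"
    proof (cases a; cases b)
      fix F G assume "a = Pos F" "b = Pos G"
      then show ?thesis using a b meets_disjoint_iff[of F G] by auto
    next
      fix F G assume "a = Pos F" "b = Neg G"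
      then show ?thesis using a b PN[of G F] by auto
    next
      fix F G assume "a = Neg F" "b = Pos G"
      then show ?thesis using a b PN[of F G] by auto
    next
      fix F G assume "a = Neg F" "b = Neg G"
      then show ?thesis using a b ex_not_meets[of "F \<union> G"] by (auto simp: meets_Un)
    qed
    \<comment> \<open>Axiality of \<open>G\<close> is essential: it prevents a bijection from
      meeting both \<open>F\<close> and \<open>G - F\<close>.\<close>
    have diff: "bijections_of (Neg (G - F)) = bijections_of (Pos F) \<union> bijections_of (Neg G)"
      if "F \<subseteq> G" "axial G" "snd ` G \<subseteq> C" for F G
    proof -
      have "axial F" "axial (G - F)" "snd ` F \<subseteq> C" "snd ` (G - F) \<subseteq> C"
        using that axial_subset[OF that(2)] by blast+
      then have "\<not> (meets f F \<and> meets f (G - F))" if "bij_betw f UNIV C" for f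
        using that meets_disjoint_iff[of F "G - F"] \<open>F \<subseteq> G\<close> \<open>axial G\<close>
        by (simp add: Un_absorb1)
      moreover have "meets f G \<longleftrightarrow> meets f F \<or> meets f (G - F)" for f
        using \<open>F \<subseteq> G\<close> by (auto simp: meets_def)
      ultimately show ?thesis by auto
    qed
    show "bijections_of c = bijections_of a \<union> bijections_of b" if "elt_join a b = Some c" for c
      using that a b diff by (cases a; cases b) (auto simp: meets_Un split: if_splits)
  qed
  have dun: "(elt_join a b \<noteq> None \<longleftrightarrow> dunion (bijections_of a) (bijections_of b) \<noteq> None) \<and>
      (\<forall>c. elt_join a b = Some c \<longrightarrow> dunion (bijections_of a) (bijections_of b) = Some (bijections_of c))"
    if "a \<in> elems (grid C)" "b \<in> elems (grid C)" for a b
    using dj[OF that] un[OF that] by (auto simp: dunion_def)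
  have "partial_algebra_of_sets UNIV (bijections_of ` elems (grid C))"
    unfolding partial_algebra_of_sets_def
  proof (intro conjI ballI allI impI)
    have "bijections_of (zero_elt (grid C)) = {}" by (simp add: meets_def)
    then show "{} \<in> bijections_of ` elems (grid C)"
      using partial_algebra_grid[of C] unfolding partial_algebra_def by (metis imageI)
  next
    fix S T U assume "S \<in> bijections_of ` elems (grid C)" "T \<in> bijections_of ` elems (grid C)"
      and U: "dunion S T = Some U"
    then obtain a b where ab: "a \<in> elems (grid C)" "b \<in> elems (grid C)"
      "S = bijections_of a" "T = bijections_of b" by blast
    then obtain c where c: "elt_join a b = Some c" using dun U by fastforce
    then have "c \<in> elems (grid C)"
      using partial_algebra_grid[of C] ab unfolding partial_algebra_def grid_simps(2) by blast
    moreover have "U = bijections_of c" using dun[OF ab(1,2)] ab(3,4) c U by simp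
    ultimately show "U \<in> bijections_of ` elems (grid C)" by blast
  qed simp
  then show ?thesis
    unfolding representation_def using inj dun
    by (auto simp: bij_betw_def meets_def simp del: grid_simps(1))
qed

section \<open>Completeness of the representation by bijections\<close>

lemma bijections_of_mono:
  assumes "a \<in> elems (grid C)" "b \<in> elems (grid C)" "lesssim (grid C) a b"
  shows "bijections_of a \<subseteq> bijections_of b"
proof -
  have "bijections_of b = bijections_of a \<union> bijections_of c"
    if c: "c \<in> elems (grid C)" "djoin (grid C) a c = Some b" for c
  proof -
    have "dunion (bijections_of a) (bijections_of c) = Some (bijections_of b)"
      using representation_grid c assms(1) unfolding representation_def by blast
    then show ?thesis by (auto simp: dunion_def split: if_splits)
  qed
  then show ?thesis using assms(3) unfolding lesssim_def by blast
qed

text \<open>If \<open>f\<close> lies in \<open>a\<close> but in no member of \<open>S\<close>, deleting a suitable cell of the graph of \<open>f\<close>, from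
  \<open>a\<close> if \<open>a\<close> is a \<open>Pos\<close> and from the unit otherwise, leaves an upper bound of \<open>S\<close> that is not above
  \<open>a\<close>.\<close>

lemma complete_representation_grid: "complete_representation (grid C) UNIV bijections_of"
  unfolding complete_representation_def
proof (intro conjI allI impI representation_grid)
  fix S a assume "pairwise_combinable (grid C) S \<and> is_supremum (grid C) S a"
  then have S: "\<And>s. s \<in> S \<Longrightarrow> s \<in> elems (grid C)"
    and comb: "\<And>s t. \<lbrakk>s \<in> S; t \<in> S; s \<noteq> t\<rbrakk> \<Longrightarrow> elt_join s t \<noteq> None"
    and a: "a \<in> elems (grid C)"
    and ub: "\<And>s. s \<in> S \<Longrightarrow> lesssim (grid C) s a"
    and least: "\<And>b. \<lbrakk>b \<in> elems (grid C); \<And>s. s \<in> S \<Longrightarrow> lesssim (grid C) s b\<rbrakk> \<Longrightarrow> lesssim (grid C) a b"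
    unfolding pairwise_combinable_def is_supremum_def grid_simps(2) by blast+
  have False if f: "f \<in> bijections_of a" and none: "\<And>s. s \<in> S \<Longrightarrow> f \<notin> bijections_of s" for f
  proof -
    have bij: "bij_betw f UNIV C" using f by (cases a) auto
    have Pos_S: "\<not> meets f F" if "Pos F \<in> S" for F using none[OF that] bij by simp
    show False
    proof (cases a)
      case (Pos G)
      then obtain k where k: "(k, f k) \<in> G" using f by (auto simp: meets_def)
      let ?b = "Pos (G - {(k, f k)})"
      have b: "?b \<in> elems (grid C)"
        using a Pos axial_subset[of G "G - {(k, f k)}"] by auto
      have "lesssim (grid C) s ?b" if s: "s \<in> S" for s
      proof (cases s)
        case (Pos F)
        have "F \<subseteq> G" using ub[OF s] S[OF s] a \<open>a = Pos G\<close> Pos lesssim_grid(1) by blast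
        moreover have "(k, f k) \<notin> F" using Pos_S[of F] s Pos by (auto simp: meets_def)
        ultimately show ?thesis using S[OF s] b Pos lesssim_grid(1) by blast
      next
        case (Neg F)
        then show ?thesis using ub[OF s] \<open>a = Pos G\<close> lesssim_grid(3) by metis
      qed
      then have "lesssim (grid C) a ?b" by (intro least b)
      then show False using a b Pos k lesssim_grid(1) by blast
    next
      case (Neg G)
      have "\<exists>k. \<forall>s\<in>S. lesssim (grid C) s (Neg {(k, f k)})"
      \<comment> \<open>Two \<open>Neg\<close> are never combinable, so \<open>S\<close> contains at
        most one \<open>Neg F\<close>. As \<open>f\<close> is not in it, \<open>f\<close> meets
        \<open>F\<close>, and that cell is the one to delete: every \<open>Pos H\<close> in
        \<open>S\<close> has \<open>H \<subseteq> F\<close> and so lies on a common line with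
        it.\<close>
      proof (cases "\<exists>F. Neg F \<in> S")
        case True
        then obtain F where F: "Neg F \<in> S" by blast
        then obtain k where k: "(k, f k) \<in> F" using none[OF F] bij by (auto simp: meets_def)
        have kC: "Neg {(k, f k)} \<in> elems (grid C)" using bij by (auto simp: bij_betw_def)
        have "lesssim (grid C) s (Neg {(k, f k)})" if s: "s \<in> S" for s
        proof (cases s)
          case (Pos H)
          have "H \<subseteq> F" using comb[OF s F] Pos by (auto split: if_splits)
          then have "axial (H \<union> {(k, f k)})"
            using S[OF F] k axial_subset[of F "H \<union> {(k, f k)}"] by auto
          moreover have "(k, f k) \<notin> H" using Pos_S[of H] s Pos by (auto simp: meets_def)
          ultimately show ?thesis using S[OF s] kC Pos lesssim_grid(2) by blast
        next
          case (Neg H)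
          then have "H = F" using comb[OF s F] by auto
          then show ?thesis using Neg S[OF s] kC k lesssim_grid(4)[of F C "{(k, f k)}"] by simp
        qed
        then show ?thesis by blast
      next
        case False
        have S_Pos: "\<exists>F. s = Pos F" if "s \<in> S" for s
          using False that by (metis elt.exhaust)
        let ?T = "\<Union>(cells ` S)"
        \<comment> \<open>With only \<open>Pos\<close> in \<open>S\<close>, pairwise combinability
          puts all their cells, possibly infinitely many, on one line. The cell to delete is then
          taken where the graph of \<open>f\<close> crosses that line.\<close>
        have "collinear p q" if pq: "p \<in> ?T" "q \<in> ?T" for p q
        proof -
          obtain s t where st: "s \<in> S" "t \<in> S" "p \<in> cells s" "q \<in> cells t" using pq by blast
          have "axial (cells s \<union> cells t)"
          proof (cases "s = t")
            case True
            then show ?thesis using S[OF st(1)] by simp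
          next
            case False
            then show ?thesis
              using comb[OF st(1,2)] S_Pos[OF st(1)] S_Pos[OF st(2)] by (auto split: if_splits)
          qed
          then show ?thesis using st unfolding axial_iff_collinear by blast
        qed
        then have "axial ?T" unfolding axial_iff_collinear by blast
        moreover have "snd ` ?T \<subseteq> C" using S by fastforce
        ultimately obtain k where k: "axial (insert (k, f k) ?T)"
        proof (cases "?T = {}")
          case True
          then show ?thesis using that axial_simps(2) by metis
        next
          case nonempty: False
          then obtain p where p: "p \<in> ?T" by blast
          then have "snd p \<in> C" using \<open>snd ` ?T \<subseteq> C\<close> by blast
          then obtain l where l: "f l = snd p" using bij by (auto simp: bij_betw_def)
          show ?thesis
          \<comment> \<open>On a row the crossing is at the row index itself; on a column it is at
            the preimage \<open>l\<close> of that column under \<open>f\<close>.\<close>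
          proof (cases "\<forall>q\<in>?T. \<forall>r\<in>?T. fst q = fst r")
            case True
            then have "\<forall>q\<in>?T. fst q = fst p" using p by blast
            then show ?thesis by (intro that[of "fst p"]) (simp add: axial_def)
          next
            case False
            then have "\<forall>q\<in>?T. snd q = snd p" using p \<open>axial ?T\<close> unfolding axial_def by blast
            then show ?thesis using l by (intro that[of l]) (simp add: axial_def)
          qed
        qed
        have kC: "Neg {(k, f k)} \<in> elems (grid C)" using bij by (auto simp: bij_betw_def)
        have "lesssim (grid C) s (Neg {(k, f k)})" if s: "s \<in> S" for s
        proof -
          obtain F where F: "s = Pos F" using S_Pos[OF s] by blast
          then have "F \<subseteq> ?T" using s by force
          then have "axial (F \<union> {(k, f k)})" using axial_subset[OF k, of "F \<union> {(k, f k)}"] by blast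
          moreover have "(k, f k) \<notin> F" using Pos_S[of F] s F by (auto simp: meets_def)
          ultimately show ?thesis using S[OF s] kC F lesssim_grid(2) by blast
        qed
        then show ?thesis by blast
      qed
      then obtain k where k: "\<And>s. s \<in> S \<Longrightarrow> lesssim (grid C) s (Neg {(k, f k)})" by blast
      have kC: "Neg {(k, f k)} \<in> elems (grid C)" using bij by (auto simp: bij_betw_def)
      have "lesssim (grid C) a (Neg {(k, f k)})" by (intro least kC k)
      then have "(k, f k) \<in> G" using a kC Neg lesssim_grid(4) by blast
      then show False using f Neg by (auto simp: meets_def)
    qed
  qed
  moreover have "bijections_of s \<subseteq> bijections_of a" if "s \<in> S" for s
    using bijections_of_mono[OF S[OF that] a ub[OF that]] .
  ultimately show "bijections_of a = (\<Union>s\<in>S. bijections_of s)" by blast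
qed

end

text \<open>An upper bound \<open>Pos G\<close> would contain a whole infinite column. For an upper
  bound \<open>Neg G\<close>, the set \<open>G\<close> avoids column \<open>j\<close> yet is
  collinear with each of its cells, which leaves only the empty set.\<close>

lemma is_supremum_column:
  fixes j :: 'j
  shows "is_supremum (grid UNIV) (range (\<lambda>i. Pos {(i, j)})) (Neg {})"
  unfolding is_supremum_def
proof (intro conjI ballI impI)
  fix s assume "s \<in> range (\<lambda>i. Pos {(i, j)})"
  then obtain i where "s = Pos {(i, j)}" by blast
  then show "lesssim (grid UNIV) s (Neg {})" using lesssim_grid(2)[of "{(i, j)}" UNIV "{}"] by simp
next
  fix b assume b: "b \<in> elems (grid (UNIV :: 'j set))"
    and ub: "\<forall>s\<in>range (\<lambda>i. Pos {(i, j)}). lesssim (grid UNIV) s b"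
  have pt: "Pos {(i, j)} \<in> elems (grid UNIV)" for i by simp
  show "lesssim (grid UNIV) (Neg {}) b"
  proof (cases b)
    case (Pos G)
    have "(i, j) \<in> G" for i using ub b Pos lesssim_grid(1)[OF pt[of i], of G] by auto
    then have "range (\<lambda>i. (i, j)) \<subseteq> G" by blast
    moreover have "infinite (range (\<lambda>i::nat. (i, j)))" by (simp add: finite_image_iff inj_on_def)
    ultimately show ?thesis using b Pos finite_subset by auto
  next
    case (Neg G)
    have G: "(i, j) \<notin> G" "axial ({(i, j)} \<union> G)" for i
      using ub b Neg lesssim_grid(2)[OF pt[of i], of G] by auto
    have "p \<notin> G" for p
    proof
      assume p: "p \<in> G"
      \<comment> \<open>The successor picks a row different from that of \<open>p\<close>, so
        collinearity must come from the column.\<close>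
      have "collinear (Suc (fst p), j) p"
        using G(2)[of "Suc (fst p)"] p unfolding axial_iff_collinear by blast
      then have "p = (fst p, j)" by (auto simp: collinear_def prod_eq_iff)
      then show False using G(1) p by metis
    qed
    then have "G = {}" by blast
    then show ?thesis using Neg by (simp add: lesssim_def)
  qed
qed simp

text \<open>A point of a complete representation assigns to every column the row of the cell containing
  it, and this assignment is injective.\<close>

lemma inj_of_complete_representation_grid:
  assumes cr: "complete_representation (grid (UNIV :: 'j set)) X \<theta>"
  shows "\<exists>g :: 'j \<Rightarrow> nat. inj g"
proof -
  have rep: "representation (grid UNIV) X \<theta>" using cr by (simp add: complete_representation_def)
  then have inj: "inj_on \<theta> (elems (grid UNIV))" and zero: "\<theta> (Pos {}) = {}"
    unfolding representation_def bij_betw_def grid_simps(3) by blast+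
  have "Pos {} \<in> elems (grid (UNIV :: 'j set))" "Neg {} \<in> elems (grid (UNIV :: 'j set))"
    by simp_all
  \<comment> \<open>Injectivity of \<open>\<theta>\<close> separates the unit from zero, so the unit
    contains a point.\<close>
  from inj_on_eq_iff[OF inj this] have "\<theta> (Neg {}) \<noteq> \<theta> (Pos {})" by simp
  then obtain x where x: "x \<in> \<theta> (Neg {})" using zero by blast
  have "\<exists>i. x \<in> \<theta> (Pos {(i, j)})" for j
  proof -
    have "pairwise_combinable (grid UNIV) (range (\<lambda>i. Pos {(i, j)}))"
      by (auto simp: pairwise_combinable_def axial_def)
    then have "\<theta> (Neg {}) = (\<Union>s\<in>range (\<lambda>i. Pos {(i, j)}). \<theta> s)"
      using is_supremum_column
      by (intro cr[unfolded complete_representation_def, THEN conjunct2, rule_format] conjI)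
    then show ?thesis using x by blast
  qed
  then obtain g where g: "\<And>j. x \<in> \<theta> (Pos {(g j, j)})" by metis
  have "inj g"
  proof (rule injI, rule ccontr)
    fix j j' assume eq: "g j = g j'" and ne: "j \<noteq> j'"
    \<comment> \<open>Distinct cells of one row are combinable, hence represented by disjoint sets,
      although \<open>x\<close> lies in both.\<close>
    have "elt_join (Pos {(g j, j)}) (Pos {(g j, j')}) \<noteq> None"
      using ne by (simp add: axial_def)
    moreover have "Pos {(g j, j)} \<in> elems (grid UNIV)" "Pos {(g j, j')} \<in> elems (grid UNIV)"
      by simp_all
    ultimately have "dunion (\<theta> (Pos {(g j, j)})) (\<theta> (Pos {(g j, j')})) \<noteq> None"
      using rep unfolding representation_def grid_simps(2) by blast
    then have "\<theta> (Pos {(g j, j)}) \<inter> \<theta> (Pos {(g j, j')}) = {}"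
      by (auto simp: dunion_def split: if_splits)
    then show False using g[of j] g[of j'] eq by auto
  qed
  then show ?thesis by blast
qed


section \<open>Transfer to the ambient type\<close>

definition image_algebra :: "('a \<Rightarrow> 'b) \<Rightarrow> 'a palgebra \<Rightarrow> 'b palgebra" where
  "image_algebra h A = \<lparr>elems = h ` elems A,
     djoin = (\<lambda>a b. map_option h (djoin A (inv h a) (inv h b))), zero_elt = h (zero_elt A)\<rparr>"

lemma image_algebra:
  assumes h: "inj h" and A: "partial_algebra A"
  shows "partial_algebra (image_algebra h A)"
    and "struct_iso h (struct_of A) (struct_of (image_algebra h A))"
proof -
  have dj: "djoin (image_algebra h A) (h a) (h b) = map_option h (djoin A a b)" for a b
    using h by (simp add: image_algebra_def)
  have elems: "elems (image_algebra h A) = h ` elems A" and zero: "zero_elt (image_algebra h A) = h (zero_elt A)"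
    by (simp_all add: image_algebra_def)
  have join: "djoin (image_algebra h A) (h a) (h b) = Some (h c) \<longleftrightarrow> djoin A a b = Some c" for a b c
    using h by (auto simp: dj inj_eq)
  have closed: "c \<in> elems A" if "a \<in> elems A" "b \<in> elems A" "djoin A a b = Some c" for a b c
    using A that unfolding partial_algebra_def by blast
  have "c \<in> h ` elems A"
    if "a \<in> elems A" "b \<in> elems A" "djoin (image_algebra h A) (h a) (h b) = Some c" for a b c
    using that closed[OF that(1,2)] unfolding dj by (cases "djoin A a b") auto
  moreover have "zero_elt A \<in> elems A" using A by (simp add: partial_algebra_def)
  ultimately show "partial_algebra (image_algebra h A)"
    unfolding partial_algebra_def elems zero by blast
  have "bij_betw h (elems A) (h ` elems A)"
    by (rule inj_on_imp_bij_betw[OF inj_on_subset[OF h subset_UNIV]])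
  then show "struct_iso h (struct_of A) (struct_of (image_algebra h A))"
    by (simp add: struct_iso_def elems zero join inj_image_mem_iff[OF h])
qed

text \<open>The even member records the row and the odd members record the column, so a code is
  never empty. This frees \<open>{}\<close> to serve as the mark of a \<open>Neg\<close> in
  \<open>elt_code\<close>.\<close>

fun cell_code :: "nat \<times> nat set \<Rightarrow> nat set" where
  "cell_code (i, x) = insert (2 * i) ((\<lambda>k. 2 * k + 1) ` x)"

fun elt_code :: "nat set elt \<Rightarrow> nat set set" where
  "elt_code (Pos F) = cell_code ` F"
| "elt_code (Neg F) = insert {} (cell_code ` F)"

lemma inj_cell_code: "inj cell_code"
proof (rule injI)
  fix p q assume eq: "cell_code p = cell_code q"
  obtain i x j y where p: "p = (i, x)" and q: "q = (j, y)" by fastforce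
  have row: "2 * n \<in> cell_code (i, x) \<longleftrightarrow> n = i" for n i x by auto presburger
  have col: "2 * n + 1 \<in> cell_code (i, x) \<longleftrightarrow> n \<in> x" for n i x
  proof -
    have "2 * n + 1 \<noteq> 2 * i" by presburger
    then show ?thesis by auto
  qed
  have "i = j" using row[of i i x] row[of i j y] eq p q by metis
  moreover have "x = y" using col[of _ i x] col[of _ j y] eq p q by blast
  ultimately show "p = q" using p q by simp
qed

lemma inj_elt_code: "inj elt_code"
proof (rule injI)
  fix a b assume eq: "elt_code a = elt_code b"
  have nonempty: "{} \<notin> cell_code ` F" for F by auto
  have "cell_code ` F \<noteq> insert {} (cell_code ` G)" for F G
    using nonempty by (metis insertI1)
  moreover have "insert {} (cell_code ` F) = insert {} (cell_code ` G) \<longleftrightarrow> F = G" for F G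
    by (simp only: insert_ident[OF nonempty nonempty] inj_image_eq_iff[OF inj_cell_code])
  ultimately show "a = b"
    using eq by (cases a; cases b) (simp_all add: inj_image_eq_iff[OF inj_cell_code], metis+)
qed

theorem theorem5p7:
  "\<not> closed_under_elementary_equivalence
       (completely_representable_structs :: nat set set struct set)"
proof
  assume closed: "closed_under_elementary_equivalence
    (completely_representable_structs :: nat set set struct set)"
  \<comment> \<open>The singletons form a countably infinite set of columns inside the uncountable
    type \<open>nat set\<close>, whose full grid is the second structure.\<close>
  define C where "C = range (\<lambda>n::nat. {n})"
  have e: "bij_betw (\<lambda>n. {n}) UNIV C" by (auto simp: C_def bij_betw_def)
  then have inf: "infinite C" using bij_betw_finite infinite_UNIV_nat by blast
  define U where "U = grid (UNIV :: nat set set)"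
  define A where "A = image_algebra elt_code (grid C)"
  define B where "B = image_algebra elt_code U"
  have A: "partial_algebra A" "struct_iso elt_code (struct_of (grid C)) (struct_of A)"
    unfolding A_def by (intro image_algebra inj_elt_code partial_algebra_grid)+
  have B: "partial_algebra B" "struct_iso elt_code (struct_of U) (struct_of B)"
    unfolding B_def U_def by (intro image_algebra inj_elt_code partial_algebra_grid)+
  have "completely_representable A"
    \<comment> \<open>The base points here are functions from \<open>nat\<close> to
      \<open>nat set\<close>; \<open>completely_representable_any_base\<close> exchanges them for
      sets of elements of \<open>A\<close>.\<close>
    using complete_representation_iso[OF struct_iso_inv[OF A(2)] A(1) partial_algebra_grid]
      complete_representation_grid[OF e] completely_representable_any_base[OF A(1)]
      is_struct_struct_of[OF partial_algebra_grid] by blast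
  then have "struct_of A \<in> completely_representable_structs"
    using A(1) by (auto simp: completely_representable_structs_def)
  moreover have "elementarily_equivalent (struct_of A) (struct_of B)"
  proof -
    have "elementarily_equivalent (struct_of (grid C)) (struct_of A)"
      "elementarily_equivalent (struct_of U) (struct_of B)"
      using A B by (auto intro!: elementarily_equivalent_iso is_struct_struct_of
          simp: U_def partial_algebra_grid)
    moreover have "elementarily_equivalent (struct_of (grid C)) (struct_of U)"
      unfolding U_def by (rule elementarily_equivalent_grid[OF inf])
    ultimately show ?thesis by (simp add: elementarily_equivalent_def)
  qed
  ultimately have "struct_of B \<in> completely_representable_structs"
    using closed is_struct_struct_of[OF B(1)] unfolding closed_under_elementary_equivalence_def by blast
  \<comment> \<open>\<open>struct_of\<close> forgets the values of \<open>djoin\<close> outside the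
    carrier, so \<open>B'\<close> need not equal \<open>B\<close>. The argument continues with
    \<open>B'\<close> through the common structure.\<close>
  then obtain B' where B': "struct_of B = struct_of B'" "partial_algebra B'" "completely_representable B'"
    by (auto simp: completely_representable_structs_def)
  then obtain X :: "nat set set set set" and \<theta> where "complete_representation B' X \<theta>"
    by (auto simp: completely_representable_def)
  then have "complete_representation U X (\<theta> \<circ> elt_code)"
    using complete_representation_iso[of elt_code U B'] B B' partial_algebra_grid
    unfolding U_def by metis
  then obtain g :: "nat set \<Rightarrow> nat" where "inj g"
    using inj_of_complete_representation_grid unfolding U_def by blast
  \<comment> \<open>An injection of \<open>nat set\<close> into \<open>nat\<close> would make its
    inverse map the numbers onto all sets of numbers, against Cantor.\<close>
  then have "inv g ` UNIV = Pow UNIV" by (simp add: inj_imp_surj_inv)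
  then show False using Cantors_theorem by blast
qed

end
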